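(* Let $\Psi:\mathbb{Q}[x]\to\mathbb{Q}$ be the linear form with $\Psi(x^n)=B_n$, where $\frac{t}{e^t-1}=\sum_{n\ge0}B_n\frac{t^n}{n!}$, and let $\mathscr{R}^-_n=\Psi\!\left(\binom{x+1}{2}^n\right)$ for $n\ge0$ (so $\mathscr{R}^-_1=-1/6$). Let $(R_n)_{n\ge0}$ be the Racah polynomials with parameters $(\alpha,\beta,\gamma,\delta)=(-1/2,1,0,0)$, and let $\Lambda$ be the unique linear form on $\mathbb{Q}[y]$ with $\Lambda(1)=1$ and $\Lambda(R_n)=0$ for all $n>0$. Then $\Lambda(y^n)=2^n\mathscr{R}^-_{n+1}/\mathscr{R}^-_1$ for all $n\ge 0$, i.e. the numbers $(2^n\mathscr{R}^-_{n+1}/\mathscr{R}^-_1)_{n\ge0}$ are the moments of this family of orthogonal polynomials.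
   Context: For parameters $\alpha,\beta,\gamma,\delta$, the Racah polynomial $R_n$ is the polynomial of degree $n$ in a variable $y$ such that, with $\lambda(x)=x(x+\gamma+\delta+1)$, $$R_n(\lambda(x))=\sum_{k=0}^{n}\frac{(-n)_k(n+\alpha+\beta+1)_k(-x)_k(x+\gamma+\delta+1)_k}{(\alpha+1)_k(\beta+\delta+1)_k(\gamma+1)_k\,k!},$$ where $(a)_k=a(a+1)\cdots(a+k-1)$ is the Pochhammer symbol. The "moments" of the family are $\Lambda(y^n)$, $n\ge 0$. *)

theory Defs
  imports "HOL-Computational_Algebra.Computational_Algebra"
begin

abbreviation linear_form :: "('a::field poly \<Rightarrow> 'a) \<Rightarrow> bool" where
  "linear_form \<equiv> Vector_Spaces.linear smult (*)"

definition bernoulli :: "nat \<Rightarrow> rat" where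
  "bernoulli n = fact n * fps_nth (fps_X / (fps_exp 1 - 1)) n"

text \<open>The linear form with value \<^term>\<open>bernoulli n\<close> at the monomial of degree \<^term>\<open>n\<close>;
  see \<open>bernoulli_form_unique\<close>.\<close>

definition bernoulli_form :: "rat poly \<Rightarrow> rat" where
  "bernoulli_form p = (\<Sum>i\<le>degree p. coeff p i * bernoulli i)"

text \<open>The polynomial "(x + 1) choose 2"; see \<open>poly_binomial_poly\<close>.\<close>

definition binomial_poly :: "rat poly" where
  "binomial_poly = smult (1 / 2) ([:1, 1:] * [:0, 1:])"

definition Rminus :: "nat \<Rightarrow> rat" where
  "Rminus n = bernoulli_form (binomial_poly ^ n)"

definition racah_lambda :: "'a::field_char_0 \<Rightarrow> 'a \<Rightarrow> 'a \<Rightarrow> 'a" where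
  "racah_lambda \<gamma> \<delta> x = x * (x + \<gamma> + \<delta> + 1)"

definition racah_sum :: "'a::field_char_0 \<Rightarrow> 'a \<Rightarrow> 'a \<Rightarrow> 'a \<Rightarrow> nat \<Rightarrow> 'a \<Rightarrow> 'a" where
  "racah_sum \<alpha> \<beta> \<gamma> \<delta> n x =
     (\<Sum>k=0..n. (pochhammer (- of_nat n) k * pochhammer (of_nat n + \<alpha> + \<beta> + 1) k
                 * pochhammer (- x) k * pochhammer (x + \<gamma> + \<delta> + 1) k)
               / (pochhammer (\<alpha> + 1) k * pochhammer (\<beta> + \<delta> + 1) k
                 * pochhammer (\<gamma> + 1) k * fact k))"

text \<open>Well-defined for the nondegenerate parameters of \<open>racah_poly_ex1\<close>.\<close>

definition racah_poly :: "'a::field_char_0 \<Rightarrow> 'a \<Rightarrow> 'a \<Rightarrow> 'a \<Rightarrow> nat \<Rightarrow> 'a poly" where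
  "racah_poly \<alpha> \<beta> \<gamma> \<delta> n =
     (THE p. degree p = n \<and> (\<forall>x. poly p (racah_lambda \<gamma> \<delta> x) = racah_sum \<alpha> \<beta> \<gamma> \<delta> n x))"

definition moment_form :: "(nat \<Rightarrow> 'a::field poly) \<Rightarrow> ('a poly \<Rightarrow> 'a) \<Rightarrow> bool" where
  "moment_form R \<Lambda> \<longleftrightarrow> linear_form \<Lambda> \<and> \<Lambda> 1 = 1 \<and> (\<forall>n>0. \<Lambda> (R n) = 0)"


lemma bernoulli_egf:
  "Abs_fps (\<lambda>n. bernoulli n / fact n) * (fps_exp 1 - 1) = fps_X"
proof -
  have nz: "fps_exp 1 - 1 \<noteq> (0 :: rat fps)"
  proof
    assume "fps_exp 1 - 1 = (0 :: rat fps)"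
    then have "fps_nth (fps_exp 1 - 1 :: rat fps) 1 = 0" by simp
    then show False by simp
  qed
  have "subdegree (fps_exp 1 - 1 :: rat fps) = 1"
    by (rule subdegreeI) auto
  then have "(fps_exp 1 - 1) dvd (fps_X :: rat fps)"
    using nz by (simp add: fps_dvd_iff)
  moreover have "Abs_fps (\<lambda>n. bernoulli n / fact n) = fps_X / (fps_exp 1 - 1)"
    by (rule fps_ext) (simp add: bernoulli_def)
  ultimately show ?thesis by simp
qed

lemma bernoulli_form_conv_sum:
  "degree p \<le> n \<Longrightarrow> bernoulli_form p = (\<Sum>i\<le>n. coeff p i * bernoulli i)"
  unfolding bernoulli_form_def
  by (rule sum.mono_neutral_left) (auto simp: coeff_eq_0)

lemma vector_space_smult: "vector_space (smult :: 'a::field \<Rightarrow> _)"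
  by unfold_locales (auto simp: smult_add_right smult_add_left)

lemma vector_space_times: "vector_space ((*) :: 'a::field \<Rightarrow> _)"
  by unfold_locales (auto simp: algebra_simps)

lemma bernoulli_form_linear: "linear_form bernoulli_form"
proof -
  have "bernoulli_form (p + q) = bernoulli_form p + bernoulli_form q" for p q
  proof -
    define n where "n = max (degree p) (degree q)"
    have "degree p \<le> n" "degree q \<le> n" "degree (p + q) \<le> n"
      by (auto simp: n_def degree_add_le_max)
    then show ?thesis
      by (simp add: bernoulli_form_conv_sum[where n = n] sum.distrib algebra_simps)
  qed
  moreover have "bernoulli_form (smult c p) = c * bernoulli_form p" for c p
    by (subst bernoulli_form_conv_sum[where n = "degree p"])
      (auto simp: bernoulli_form_def sum_distrib_left mult.assoc)
  ultimately show ?thesis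
    using vector_space_smult vector_space_times
    by (auto simp: Vector_Spaces.linear_iff)
qed

lemma bernoulli_form_monom: "bernoulli_form (monom 1 n) = bernoulli n"
proof -
  have "bernoulli_form (monom 1 n) = (\<Sum>i\<le>n. coeff (monom 1 n) i * bernoulli i)"
    by (rule bernoulli_form_conv_sum) (simp add: degree_monom_eq)
  also have "\<dots> = (\<Sum>i\<le>n. if i = n then bernoulli n else 0)"
    by (rule sum.cong) auto
  finally show ?thesis by simp
qed

lemma linear_form_expand:
  assumes "linear_form \<Lambda>"
  shows "\<Lambda> p = (\<Sum>i\<le>degree p. coeff p i * \<Lambda> (monom 1 i))"
proof -
  have add: "\<Lambda> (p + q) = \<Lambda> p + \<Lambda> q" and scale: "\<Lambda> (smult c p) = c * \<Lambda> p" for p q c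
    using assms by (auto simp: Vector_Spaces.linear_iff)
  have zero: "\<Lambda> 0 = 0" using scale[of 0 0] by simp
  have *: "\<Lambda> (sum f A) = (\<Sum>i\<in>A. \<Lambda> (f i))" if "finite A" for f and A :: "nat set"
    using that by induction (auto simp: zero add)
  have "\<Lambda> p = \<Lambda> (\<Sum>i\<le>degree p. monom (coeff p i) i)"
    by (simp add: poly_as_sum_of_monoms)
  also have "\<dots> = (\<Sum>i\<le>degree p. \<Lambda> (smult (coeff p i) (monom 1 i)))"
    by (simp add: * smult_monom)
  finally show ?thesis by (simp add: scale)
qed

lemma bernoulli_form_unique:
  "linear_form \<Psi> \<and> (\<forall>n. \<Psi> (monom 1 n) = bernoulli n) \<longleftrightarrow> \<Psi> = bernoulli_form"
proof safe
  assume "linear_form \<Psi>" "\<forall>n. \<Psi> (monom 1 n) = bernoulli n"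
  then show "\<Psi> = bernoulli_form"
    by (intro ext) (subst linear_form_expand, simp_all add: bernoulli_form_def)
qed (auto simp: bernoulli_form_linear bernoulli_form_monom)

lemma poly_binomial_poly: "poly binomial_poly x = (x + 1) gchoose 2"
  by (simp add: binomial_poly_def gbinomial_prod_rev numeral_2_eq_2 prod.atLeast0_lessThan_Suc)

lemma pochhammer_racah:
  fixes x c :: "'a::field_char_0"
  shows "pochhammer (- x) k * pochhammer (x + c) k =
         poly (\<Prod>j<k. [:of_nat j * (of_nat j + c), -1:]) (x * (x + c))"
  by (induction k) (auto simp: pochhammer_Suc algebra_simps)

lemma degree_prod_racah:
  fixes c :: "'a::field_char_0"
  shows "degree (\<Prod>j<k. [:of_nat j * (of_nat j + c), -1:]) = k"
  by (subst degree_prod_sum_eq) auto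

lemma infinite_range_racah_lambda:
  "infinite (range (racah_lambda \<gamma> (\<delta> :: 'a::field_char_0)))"
proof
  assume fin: "finite (range (racah_lambda \<gamma> \<delta>))"
  have "finite {x. racah_lambda \<gamma> \<delta> x = y}" for y
  proof -
    have "{x. racah_lambda \<gamma> \<delta> x = y} = {x. poly [:- y, \<gamma> + \<delta> + 1, 1:] x = 0}"
      by (auto simp: racah_lambda_def algebra_simps)
    also have "finite \<dots>" by (rule poly_roots_finite) auto
    finally show ?thesis .
  qed
  then have "finite (\<Union>y\<in>range (racah_lambda \<gamma> \<delta>). {x. racah_lambda \<gamma> \<delta> x = y})"
    using fin by blast
  also have "(\<Union>y\<in>range (racah_lambda \<gamma> \<delta>). {x. racah_lambda \<gamma> \<delta> x = y}) = UNIV" by auto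
  finally show False using infinite_UNIV_char_0 by blast
qed

lemma racah_poly_ex1:
  fixes \<alpha> \<beta> \<gamma> \<delta> :: "'a::field_char_0"
  assumes "pochhammer (of_nat n + \<alpha> + \<beta> + 1) n \<noteq> 0"
    and "pochhammer (\<alpha> + 1) n \<noteq> 0" "pochhammer (\<beta> + \<delta> + 1) n \<noteq> 0" "pochhammer (\<gamma> + 1) n \<noteq> 0"
  shows "\<exists>!p. degree p = n \<and> (\<forall>x. poly p (racah_lambda \<gamma> \<delta> x) = racah_sum \<alpha> \<beta> \<gamma> \<delta> n x)"
proof -
  define a where "a = (\<lambda>k. (pochhammer (- of_nat n) k * pochhammer (of_nat n + \<alpha> + \<beta> + 1) k)
     / (pochhammer (\<alpha> + 1) k * pochhammer (\<beta> + \<delta> + 1) k * pochhammer (\<gamma> + 1) k * fact k))"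
  define q :: "nat \<Rightarrow> 'a poly"
    where "q = (\<lambda>k. \<Prod>j<k. [:of_nat j * (of_nat j + (\<gamma> + \<delta> + 1)), -1:])"
  define p where "p = (\<Sum>k\<le>n. smult (a k) (q k))"
  have dq: "degree (q k) = k" for k
    unfolding q_def by (rule degree_prod_racah)
  have "pochhammer (- of_nat n :: 'a) n \<noteq> 0"
    by (simp add: pochhammer_same)
  then have "a n \<noteq> 0" using assms by (auto simp: a_def)
  moreover have "coeff (q n) n \<noteq> 0"
  proof -
    have "q n \<noteq> 0" by (simp add: q_def)
    then have "lead_coeff (q n) \<noteq> 0" by simp
    then show ?thesis unfolding dq .
  qed
  moreover have "coeff p n = a n * coeff (q n) n"
  proof -
    have "coeff p n = (\<Sum>k\<le>n. if k = n then a n * coeff (q n) n else 0)"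
      unfolding p_def coeff_sum by (rule sum.cong) (auto simp: coeff_eq_0 dq)
    then show ?thesis by simp
  qed
  ultimately have "coeff p n \<noteq> 0" by simp
  moreover have "degree p \<le> n"
    unfolding p_def by (rule degree_sum_le) (auto intro: order.trans[OF degree_smult_le] simp: dq)
  ultimately have deg: "degree p = n"
    by (intro le_antisym le_degree)
  have ev: "poly p (racah_lambda \<gamma> \<delta> x) = racah_sum \<alpha> \<beta> \<gamma> \<delta> n x" for x
  proof -
    have "poly p (racah_lambda \<gamma> \<delta> x) =
        (\<Sum>k\<le>n. a k * (pochhammer (- x) k * pochhammer (x + (\<gamma> + \<delta> + 1)) k))"
      unfolding pochhammer_racah
      by (simp add: p_def poly_sum q_def racah_lambda_def add.assoc)
    also have "\<dots> = racah_sum \<alpha> \<beta> \<gamma> \<delta> n x"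
      unfolding racah_sum_def atLeast0AtMost
      by (rule sum.cong) (auto simp: a_def add.assoc)
    finally show ?thesis .
  qed
  show ?thesis
  proof (rule ex1I[of _ p])
    fix r assume r: "degree r = n \<and> (\<forall>x. poly r (racah_lambda \<gamma> \<delta> x) = racah_sum \<alpha> \<beta> \<gamma> \<delta> n x)"
    show "r = p"
    proof (rule ccontr)
      assume "r \<noteq> p"
      then have "finite {y. poly (r - p) y = 0}" by (intro poly_roots_finite) auto
      moreover have "range (racah_lambda \<gamma> \<delta>) \<subseteq> {y. poly (r - p) y = 0}"
        using r ev by auto
      ultimately show False
        using infinite_range_racah_lambda finite_subset by blast
    qed
  qed (use deg ev in auto)
qed

end

theory Submission
  imports Defs
begin

text \<open>
  The form \<open>p(y) \<mapsto> \<Psi>(binomial_poly * p(x(x+1))) / Rminus 1\<close> has the required moments, so it has to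
  vanish on \<open>R\<^sub>n\<close> for \<open>n > 0\<close>. Put \<open>q\<^sub>k(x) = (-x)\<^sub>k (x+1)\<^sub>k\<close>. Since
  \<open>(2k+1) q\<^sub>k(x) = F(x+1) - F(x)\<close> for \<open>F(x) = x (1-x)\<^sub>k (1+x)\<^sub>k\<close>, and \<open>\<Psi>(F(x+1) - F(x)) = F'(0)\<close>,
  one gets \<open>\<Psi>(q\<^sub>k) = k!\<^sup>2 / (2k+1)\<close>. From \<open>x(x+1) q\<^sub>k = k(k+1) q\<^sub>k - q\<^sub>k\<^sub>+\<^sub>1\<close> it follows that
  \<open>\<Psi>(x(x+1) q\<^sub>k) = - k! (k+1)! / ((2k+1)(2k+3))\<close>, and then the value of the form on \<open>R\<^sub>n\<close> is,
  up to a constant factor, the sum \<open>\<^sub>2F\<^sub>1(-n, n+3/2; 5/2; 1)\<close>, which by Chu-Vandermonde equals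
  \<open>(1-n)\<^sub>n / (5/2)\<^sub>n = 0\<close>.
\<close>

lemma linear_form_simps:
  assumes "linear_form L"
  shows "L (p + q) = L p + L q" "L (p - q) = L p - L q" "L (smult c p) = c * L p"
    "L (sum f A) = (\<Sum>i\<in>A. L (f i))"
proof -
  interpret L: Vector_Spaces.linear smult "(*)" L by fact
  show "L (p + q) = L p + L q" "L (p - q) = L p - L q" "L (smult c p) = c * L p"
    "L (sum f A) = (\<Sum>i\<in>A. L (f i))"
    by (rule L.add L.diff L.scale L.sum)+
qed

lemmas bernoulli_form_simps = linear_form_simps[OF bernoulli_form_linear]

text \<open>Coefficient comparison in \<open>bernoulli_egf\<close>. Passing from exp to exp - 1
  drops the summand i = n, hence \<open>bernoulli n\<close> on the right.\<close>

lemma bernoulli_binomial_sum: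
  "(\<Sum>i\<le>n. of_nat (n choose i) * bernoulli i) = bernoulli n + (if n = 1 then 1 else 0)"
proof -
  have "(\<Sum>i\<le>n. bernoulli i / fact i * (1 / fact (n - i) - (if i = n then 1 else 0))) =
      fps_nth (Abs_fps (\<lambda>n. bernoulli n / fact n) * (fps_exp 1 - 1)) n"
    unfolding fps_mult_nth atLeast0AtMost by (rule sum.cong) auto
  also have "\<dots> = (if n = 1 then 1 else 0)"
    by (simp add: bernoulli_egf)
  finally have *: "(\<Sum>i\<le>n. bernoulli i / fact i * (1 / fact (n - i) - (if i = n then 1 else 0))) =
      (if n = 1 then 1 else 0)" .
  have "(\<Sum>i\<le>n. of_nat (n choose i) * bernoulli i) - bernoulli n =
      (\<Sum>i\<le>n. of_nat (n choose i) * bernoulli i - (if i = n then bernoulli n else 0))"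
    by (simp add: sum_subtractf)
  also have "\<dots> = (\<Sum>i\<le>n. fact n *
      (bernoulli i / fact i * (1 / fact (n - i) - (if i = n then 1 else 0))))"
  proof (rule sum.cong)
    fix i assume "i \<in> {..n}"
    then show "of_nat (n choose i) * bernoulli i - (if i = n then bernoulli n else 0) =
        fact n * (bernoulli i / fact i * (1 / fact (n - i) - (if i = n then 1 else 0)))"
      by (cases "i = n") (simp_all add: binomial_fact)
  qed simp
  also have "\<dots> = (if n = 1 then 1 else 0)"
    unfolding sum_distrib_left[symmetric] * by simp
  finally show ?thesis by simp
qed

text \<open>\<open>coeff p 1\<close> is p'(0). On monomials this is
  \<open>bernoulli_binomial_sum\<close>; linearity does the rest.\<close>

lemma bernoulli_form_shift:
  "bernoulli_form (p \<circ>\<^sub>p [:1, 1:]) = bernoulli_form p + coeff p 1"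
proof -
  have monom: "bernoulli_form (monom 1 n \<circ>\<^sub>p [:1, 1:]) = bernoulli n + (if n = 1 then 1 else 0)" for n
  proof -
    have "(monom 1 n \<circ>\<^sub>p [:1, 1:] :: rat poly) = ([:0, 1:] + 1) ^ n"
      by (intro poly_eq_poly_eq_iff[THEN iffD1] ext)
         (simp add: poly_pcompose poly_monom algebra_simps)
    also have "\<dots> = (\<Sum>i\<le>n. smult (of_nat (n choose i)) (monom 1 i))"
      unfolding binomial_ring by (simp add: of_nat_poly monom_altdef)
    finally show ?thesis
      by (simp add: bernoulli_form_simps bernoulli_form_monom
          bernoulli_binomial_sum)
  qed
  have "p \<circ>\<^sub>p [:1, 1:] = (\<Sum>i\<le>degree p. smult (coeff p i) (monom 1 i)) \<circ>\<^sub>p [:1, 1:]"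
    by (simp add: smult_monom poly_as_sum_of_monoms)
  also have "\<dots> = (\<Sum>i\<le>degree p. smult (coeff p i) (monom 1 i \<circ>\<^sub>p [:1, 1:]))"
    by (simp add: pcompose_sum pcompose_smult)
  finally have "bernoulli_form (p \<circ>\<^sub>p [:1, 1:]) =
      (\<Sum>i\<le>degree p. coeff p i * (bernoulli i + (if i = 1 then 1 else 0)))"
    by (simp add: bernoulli_form_simps monom)
  also have "\<dots> = bernoulli_form p + (\<Sum>i\<le>degree p. if i = 1 then coeff p 1 else 0)"
    unfolding bernoulli_form_def sum.distrib[symmetric] by (rule sum.cong) (auto simp: distrib_left)
  \<comment> \<open>If \<open>degree p = 0\<close>, the index 1 is out of range, but then
    \<open>coeff p 1\<close> is 0 as well.\<close>
  also have "(\<Sum>i\<le>degree p. if i = 1 then coeff p 1 else 0) = coeff p 1"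
    by (auto simp: coeff_eq_0)
  finally show ?thesis .
qed

text \<open>The q_k from above, as a polynomial in x rather than in y = x(x+1).\<close>

definition pochhammer_pair :: "nat \<Rightarrow> rat poly" where
  "pochhammer_pair k = (\<Prod>j<k. [:of_nat j, -1:] * [:of_nat j + 1, 1:])"

lemma poly_pochhammer_pair:
  "poly (pochhammer_pair k) x = pochhammer (- x) k * pochhammer (x + 1) k"
  unfolding pochhammer_pair_def
  by (induction k) (simp_all add: pochhammer_Suc del: mult_pCons_left mult_pCons_right)

text \<open>The new factor of \<open>pochhammer_pair (Suc k)\<close> is (k - x)(k + 1 + x) = k(k+1)
  - x(x+1).\<close>

lemma pochhammer_pair_Suc:
  "[:0, 1, 1:] * pochhammer_pair k =
     smult (of_nat k * (of_nat k + 1)) (pochhammer_pair k) - pochhammer_pair (Suc k)"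
  by (intro poly_eq_poly_eq_iff[THEN iffD1] ext)
     (simp add: poly_pochhammer_pair pochhammer_Suc algebra_simps)

lemma bernoulli_form_pochhammer_pair:
  "bernoulli_form (pochhammer_pair k) = (fact k)\<^sup>2 / (2 * of_nat k + 1)"
proof -
  define G :: "rat poly" where "G = (\<Prod>j<k. [:of_nat j + 1, -1:] * [:of_nat j + 1, 1:])"
  define F where "F = pCons 0 G"
  have G: "poly G x = pochhammer (1 - x) k * pochhammer (1 + x) k" for x
    unfolding G_def
    by (induction k) (simp_all add: pochhammer_Suc add_ac mult_ac del: mult_pCons_left mult_pCons_right)
  have "F \<circ>\<^sub>p [:1, 1:] = F + smult (2 * of_nat k + 1) (pochhammer_pair k)"
  proof (intro poly_eq_poly_eq_iff[THEN iffD1] ext)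
    fix x :: rat
    \<comment> \<open>These two identities extract q_k from both terms: F(x+1) = (x+1+k) q_k(x) and
      F(x) = (x-k) q_k(x), with difference (2k+1) q_k(x).\<close>
    have 1: "(x + 1) * pochhammer (x + 2) k = pochhammer (x + 1) k * (x + 1 + of_nat k)"
      using pochhammer_rec[of "x + 1" k] pochhammer_Suc[of "x + 1" k] by (simp add: add.assoc)
    have 2: "- x * pochhammer (1 - x) k = pochhammer (- x) k * (of_nat k - x)"
      using pochhammer_rec[of "- x" k] pochhammer_Suc[of "- x" k] by simp
    have "poly (F \<circ>\<^sub>p [:1, 1:]) x = pochhammer (- x) k * ((x + 1) * pochhammer (x + 2) k)"
      by (simp add: F_def poly_pcompose G algebra_simps)
    moreover have "poly F x = - (- x * pochhammer (1 - x) k) * pochhammer (x + 1) k"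
      by (simp add: F_def G algebra_simps)
    ultimately show "poly (F \<circ>\<^sub>p [:1, 1:]) x = poly (F + smult (2 * of_nat k + 1) (pochhammer_pair k)) x"
      unfolding 1 2 poly_add poly_smult poly_pochhammer_pair
      by (simp add: algebra_simps)
  qed
  then have "coeff F 1 = (2 * of_nat k + 1) * bernoulli_form (pochhammer_pair k)"
    using bernoulli_form_shift[of F] by (simp add: bernoulli_form_simps)
  \<comment> \<open>Since F = x G, this coefficient is G(0) = (1)_k (1)_k.\<close>
  moreover have "coeff F 1 = (fact k)\<^sup>2"
    using G[of 0] by (simp add: F_def poly_0_coeff_0 power2_eq_square pochhammer_fact[symmetric])
  moreover have "2 * of_nat k + 1 \<noteq> (0 :: rat)"
    by (intro less_imp_neq[symmetric] add_nonneg_pos; simp)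
  ultimately show ?thesis
    by (simp add: field_simps)
qed

lemma bernoulli_form_times_pochhammer_pair:
  "bernoulli_form ([:0, 1, 1:] * pochhammer_pair k) =
     - (fact k * fact (k + 1)) / ((2 * of_nat k + 1) * (2 * of_nat k + 3))"
proof -
  have nz: "2 * of_nat k + 1 \<noteq> (0 :: rat)" "2 * of_nat k + 3 \<noteq> (0 :: rat)"
    by (intro less_imp_neq[symmetric] add_nonneg_pos; simp)+
  have "bernoulli_form ([:0, 1, 1:] * pochhammer_pair k) =
      of_nat k * (of_nat k + 1) * ((fact k)\<^sup>2 / (2 * of_nat k + 1))
      - (fact (Suc k))\<^sup>2 / (2 * of_nat k + 3)"
    unfolding pochhammer_pair_Suc bernoulli_form_simps
      bernoulli_form_pochhammer_pair
    by (simp add: algebra_simps)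
  \<comment> \<open>With k! (k+1)! pulled out, the numerator is k(2k+3) - (k+1)(2k+1) = -1.\<close>
  also have "\<dots> = - (fact k * fact (k + 1)) / ((2 * of_nat k + 1) * (2 * of_nat k + 3))"
    using nz by (simp add: divide_simps power2_eq_square) (simp add: algebra_simps)
  finally show ?thesis .
qed

text \<open>\<open>racah_poly\<close> is a definite description, so nondegeneracy has to be checked:
  the Pochhammer symbols start at n + 3/2, 1/2, 2 and 1, all positive.\<close>

lemma racah_poly_spec:
  "degree (racah_poly (- 1 / 2) 1 0 (0 :: rat) n) = n \<and>
   (\<forall>x. poly (racah_poly (- 1 / 2) 1 0 (0 :: rat) n) (racah_lambda 0 0 x) =
     racah_sum (- 1 / 2) 1 0 0 n x)"
  unfolding racah_poly_def
proof (rule theI', rule racah_poly_ex1)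
  have pos: "pochhammer x n \<noteq> 0" if "x > 0" for x :: rat
    using pochhammer_pos[OF that, of n] by simp
  show "pochhammer (of_nat n + - 1 / 2 + 1 + 1) n \<noteq> (0 :: rat)"
    by (rule pos) (simp add: add_nonneg_pos add.assoc)
qed (auto intro!: pochhammer_pos less_imp_neq[symmetric])

text \<open>For gamma = delta = 0, y = x(x+1) is the substitution \<open>racah_lambda\<close>. The
  factor \<open>binomial_poly\<close> produces the index shift to n + 1 in the moments, and
  \<open>Rminus 1\<close> normalizes the value at 1.\<close>

definition racah_form :: "rat poly \<Rightarrow> rat" where
  "racah_form p = bernoulli_form (binomial_poly * (p \<circ>\<^sub>p [:0, 1, 1:])) / Rminus 1"

lemma binomial_poly_conv: "binomial_poly = smult (1 / 2) [:0, 1, 1:]"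
  by (simp add: binomial_poly_def)

lemma linear_form_racah_form: "linear_form racah_form"
  using vector_space_smult vector_space_times
  by (auto simp: Vector_Spaces.linear_iff racah_form_def pcompose_add pcompose_smult
      distrib_left bernoulli_form_simps add_divide_distrib)

text \<open>The power of 2 arises because x(x+1) is twice \<open>binomial_poly\<close>.\<close>

lemma racah_form_monom: "racah_form (monom 1 n) = 2 ^ n * Rminus (n + 1) / Rminus 1"
proof -
  have "monom 1 n \<circ>\<^sub>p [:0, 1, 1:] = smult (2 ^ n) (binomial_poly ^ n)"
    by (intro poly_eq_poly_eq_iff[THEN iffD1] ext)
       (simp add: binomial_poly_conv poly_pcompose poly_monom
          power_mult_distrib[symmetric] algebra_simps)
  then show ?thesis
    by (simp add: racah_form_def Rminus_def bernoulli_form_simps)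
qed

lemma Rminus_1: "Rminus 1 = - 1 / 6"
proof -
  have "Rminus 1 = bernoulli_form (smult (1 / 2) ([:0, 1, 1:] * pochhammer_pair 0))"
    by (simp add: Rminus_def binomial_poly_conv pochhammer_pair_def)
  then show ?thesis
    unfolding bernoulli_form_simps bernoulli_form_times_pochhammer_pair by simp
qed

lemma racah_form_racah_poly:
  assumes "n > 0"
  shows "racah_form (racah_poly (- 1 / 2) 1 0 0 n) = 0"
proof -
  \<comment> \<open>The coefficient of q_k in R_n(x(x+1)); n + alpha + beta + 1 is n + 3/2.\<close>
  define a :: "nat \<Rightarrow> rat" where "a k = pochhammer (- of_nat n) k * pochhammer (3 / 2 + of_nat n) k
     / (pochhammer (1 / 2) k * pochhammer 2 k * pochhammer 1 k * fact k)" for k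
  have "racah_poly (- 1 / 2) 1 0 0 n \<circ>\<^sub>p [:0, 1, 1:] = (\<Sum>k=0..n. smult (a k) (pochhammer_pair k))"
  proof (intro poly_eq_poly_eq_iff[THEN iffD1] ext)
    fix x :: rat
    have "poly (racah_poly (- 1 / 2) 1 0 0 n \<circ>\<^sub>p [:0, 1, 1:]) x = racah_sum (- 1 / 2) 1 0 0 n x"
      using racah_poly_spec[of n] by (simp add: poly_pcompose racah_lambda_def algebra_simps)
    then show "poly (racah_poly (- 1 / 2) 1 0 0 n \<circ>\<^sub>p [:0, 1, 1:]) x =
        poly (\<Sum>k=0..n. smult (a k) (pochhammer_pair k)) x"
      by (simp add: racah_sum_def poly_sum poly_pochhammer_pair a_def add.assoc mult.assoc)
  qed
  then have "binomial_poly * (racah_poly (- 1 / 2) 1 0 0 n \<circ>\<^sub>p [:0, 1, 1:]) =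
      (\<Sum>k=0..n. smult (a k / 2) ([:0, 1, 1:] * pochhammer_pair k))"
    by (simp only: binomial_poly_conv sum_distrib_left mult_smult_left mult_smult_right smult_smult) simp
  then have "bernoulli_form (binomial_poly * (racah_poly (- 1 / 2) 1 0 0 n \<circ>\<^sub>p [:0, 1, 1:])) =
      (\<Sum>k=0..n. a k / 2 * bernoulli_form ([:0, 1, 1:] * pochhammer_pair k))"
    by (simp add: bernoulli_form_simps del: mult_pCons_left)
  also have "\<dots> = (\<Sum>k=0..n. - 1 / 6 *
      (pochhammer (3 / 2 + of_nat n) k * pochhammer (- of_nat n) k
        / (of_nat (fact k) * pochhammer (5 / 2) k)))"
  proof (rule sum.cong)
    fix k
    \<comment> \<open>Splitting two factors off (1/2)_(k+2), once at the end and once at the start,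
      relates (1/2)_k to (5/2)_k.\<close>
    have "pochhammer (1 / 2) (k + 2) = pochhammer (1 / 2) k * (1 / 2 + of_nat k) * (3 / 2 + of_nat k :: rat)"
      by (simp add: pochhammer_Suc numeral_2_eq_2)
    moreover have "pochhammer (1 / 2) (2 + k) = (3 / 4) * pochhammer (5 / 2 :: rat) k"
      by (simp add: pochhammer_rec numeral_2_eq_2)
    ultimately have half: "pochhammer (1 / 2) k * ((2 * of_nat k + 1) * (2 * of_nat k + 3)) =
        3 * pochhammer (5 / 2 :: rat) k"
      by (simp add: field_simps)
    have two: "pochhammer 2 k = (fact (k + 1) :: rat)"
      using pochhammer_rec[of "1 :: rat" k] by (simp add: pochhammer_fact)
    \<comment> \<open>To be read with f = k!, g = (k+1)!, h = (1/2)_k and d = (2k+1)(2k+3).\<close>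
    have "(p * q / (h * g * f * f)) / 2 * (- (f * g) / d) = - (p * q) / (2 * (h * d) * f)"
      if "f \<noteq> 0" "g \<noteq> 0" for p q h g f d :: rat
      using that by (simp add: divide_simps)
    from this[OF fact_nonzero fact_nonzero]
    have "a k / 2 * bernoulli_form ([:0, 1, 1:] * pochhammer_pair k) =
      - (pochhammer (- of_nat n) k * pochhammer (3 / 2 + of_nat n) k) /
       (2 * (pochhammer (1 / 2) k * ((2 * of_nat k + 1) * (2 * of_nat k + 3))) * fact k)"
      unfolding bernoulli_form_times_pochhammer_pair a_def two pochhammer_fact[symmetric] .
    then show "a k / 2 * bernoulli_form ([:0, 1, 1:] * pochhammer_pair k) = - 1 / 6 *
      (pochhammer (3 / 2 + of_nat n) k * pochhammer (- of_nat n) k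
        / (of_nat (fact k) * pochhammer (5 / 2) k))"
      unfolding half by (simp add: field_simps)
  qed simp
  also have "\<dots> = - 1 / 6 * (pochhammer (5 / 2 - (3 / 2 + of_nat n)) n / pochhammer (5 / 2) n)"
    unfolding sum_distrib_left[symmetric]
  proof (subst Vandermonde_pochhammer)
    have "5 / 2 + of_nat j > (0 :: rat)" for j by (simp add: add_pos_nonneg)
    then show "\<forall>j\<in>{0..<n}. 5 / 2 \<noteq> - (of_nat j :: rat)"
      by (metis add.left_inverse less_irrefl)
  qed simp
  \<comment> \<open>The base is 1 - n, so the last of the n factors is 0; for n = 0 the product
    would be empty and equal to 1.\<close>
  also have "pochhammer (5 / 2 - (3 / 2 + of_nat n)) n = (0 :: rat)"
    unfolding pochhammer_eq_0_iff using assms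
    by (intro exI[of _ "n - 1"]) (simp add: of_nat_diff)
  finally show ?thesis
    by (simp add: racah_form_def)
qed

lemma moment_form_racah_form: "moment_form (racah_poly (- 1 / 2) 1 0 0) racah_form"
  using linear_form_racah_form racah_form_racah_poly racah_form_monom[of 0] Rminus_1
  by (simp add: moment_form_def)

text \<open>Induction on the degree: subtracting a multiple of \<open>R n\<close>, on which both
  forms vanish, removes the leading term. Constants are settled by the value at 1.\<close>

lemma moment_form_unique:
  assumes deg: "\<And>n. degree (R n) = n" and L: "moment_form R L" and M: "moment_form R M"
  shows "L = M"
proof
  have lin: "linear_form L" "linear_form M"
    using L M by (auto simp: moment_form_def)
  note simps = linear_form_simps[OF lin(1)] linear_form_simps[OF lin(2)]
  fix p
  show "L p = M p"
  proof (induction "degree p" arbitrary: p rule: less_induct)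
    case less
    show ?case
    proof (cases "degree p = 0")
      case True
      then obtain c where "p = smult c 1"
        by (metis degree_0_id one_pCons smult_pCons mult.right_neutral smult_0_right)
      then show ?thesis
        using L M by (simp only: simps moment_form_def)
    next
      case False
      define n where "n = degree p"
      define c where "c = lead_coeff p / coeff (R n) n"
      have "coeff (R n) n \<noteq> 0"
        using False deg[of n] by (metis degree_0 leading_coeff_0_iff n_def)
      then have "coeff (p - smult c (R n)) n = 0"
        by (simp add: c_def n_def)
      moreover have "degree (p - smult c (R n)) \<le> n"
        by (rule degree_diff_le) (auto simp: n_def deg intro: order.trans[OF degree_smult_le])
      \<comment> \<open>Degree exactly n would make the leading coefficient 0, hence the polynomial
        0 and n = 0.\<close>
      ultimately have "degree (p - smult c (R n)) < degree p"
        using False by (metis degree_0 leading_coeff_0_iff le_neq_implies_less n_def neq0_conv)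
      from less[OF this] show ?thesis
        using L M False by (simp add: simps moment_form_def n_def)
    qed
  qed
qed

theorem theorem2p2:
  shows "Rminus 1 = - 1 / 6 \<and>
    (\<exists>!\<Lambda>. moment_form (racah_poly (- 1 / 2) 1 0 (0 :: rat)) \<Lambda>) \<and>
    (\<forall>\<Lambda>. moment_form (racah_poly (- 1 / 2) 1 0 (0 :: rat)) \<Lambda> \<longrightarrow>
         (\<forall>n. \<Lambda> (monom 1 n) = 2 ^ n * Rminus (n + 1) / Rminus 1))"
proof -
  have "\<Lambda> = racah_form" if "moment_form (racah_poly (- 1 / 2) 1 0 (0 :: rat)) \<Lambda>" for \<Lambda>
    using moment_form_unique that moment_form_racah_form racah_poly_spec by blast
  then show ?thesis
    using moment_form_racah_form racah_form_monom Rminus_1 by blast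
qed

end
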